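(* Let $n,m$ be integers with $2\le n\le m$ and $m\geq (n-2)(n-1)$. Let $S^*_{n,m}$ be the scramble on $K_n\square K_m$ whose eggs are all connected vertex subsets of size $n-1$. Then $sn(K_n\square K_m)=\|S^*_{n,m}\|=(n-1)m$.
   Context: $K_n$ is the complete graph on $n$ vertices. $G\square H$ is the Cartesian product of graphs: vertices are pairs $(x,y)$ with $x\in V(G)$, $y\in V(H)$; $(x,y_1)\sim(x,y_2)$ when $y_1\sim y_2$ in $H$, and $(x_1,y)\sim(x_2,y)$ when $x_1\sim x_2$ in $G$. Let $G$ be a finite connected loopless graph. A scramble $S$ on $G$ is a collection of non-empty vertex subsets of $G$, called eggs, each of which is connected (i.e. induces a connected subgraph). A hitting set of $S$ is a set $H\subseteq V(G)$ with $H\cap E\ne\emptyset$ for every egg $E$ of $S$. An egg cut of $S$ is a partition $V(G)=X\sqcup Y$ such that there are eggs $E_1\subseteq X$ and $E_2\subseteq Y$; its egg cut set is $E(X,Y)$, the set of edges with one end in $X$ and the other in $Y$. The order $\|S\|$ is the minimum of the smallest size $|H|$ of a hitting set of $S$ and the smallest size $|E(X,Y)|$ of an egg cut set of $S$ (if $S$ has no egg cut, the order is the smallest size of a hitting set). The scramble number $sn(G)$ is the largest order of a scramble on $G$. *)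

theory Defs
  imports "Graph_Theory.Graph_Theory"
begin

text \<open>
  Undirected graphs are symmetric digraphs, as in the Graph_Theory library: an edge between
  u and v is a pair of opposite arcs.
\<close>

definition cartesian_product ::
    "'a pair_pre_digraph \<Rightarrow> 'b pair_pre_digraph \<Rightarrow> ('a \<times> 'b) pair_pre_digraph"
    (infixr \<open>\<box>\<close> 75) where
  "G \<box> H = \<lparr> pverts = pverts G \<times> pverts H,
             parcs = {((x, y1), (x, y2)) | x y1 y2. x \<in> pverts G \<and> (y1, y2) \<in> parcs H}
                   \<union> {((x1, y), (x2, y)) | x1 x2 y. (x1, x2) \<in> parcs G \<and> y \<in> pverts H} \<rparr>"

definition connected_vertex_set :: "('a, 'b) pre_digraph \<Rightarrow> 'a set \<Rightarrow> bool" where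
  "connected_vertex_set G A \<longleftrightarrow>
     A \<noteq> {} \<and> A \<subseteq> verts G \<and> Digraph_Component.connected (G \<restriction> A)"

definition is_scramble :: "('a, 'b) pre_digraph \<Rightarrow> 'a set set \<Rightarrow> bool" where
  "is_scramble G S \<longleftrightarrow> (\<forall>E \<in> S. connected_vertex_set G E)"

definition hitting_set :: "('a, 'b) pre_digraph \<Rightarrow> 'a set set \<Rightarrow> 'a set \<Rightarrow> bool" where
  "hitting_set G S H \<longleftrightarrow> H \<subseteq> verts G \<and> (\<forall>E \<in> S. H \<inter> E \<noteq> {})"

definition egg_cut :: "('a, 'b) pre_digraph \<Rightarrow> 'a set set \<Rightarrow> 'a set \<Rightarrow> 'a set \<Rightarrow> bool" where
  "egg_cut G S X Y \<longleftrightarrow>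
     X \<union> Y = verts G \<and> X \<inter> Y = {} \<and> (\<exists>E1 \<in> S. \<exists>E2 \<in> S. E1 \<subseteq> X \<and> E2 \<subseteq> Y)"

text \<open>
  For disjoint X and Y, each undirected edge between X and Y contributes exactly one arc from
  X to Y, so the following set has as many elements as there are edges between X and Y.
\<close>

definition edges_between :: "('a, 'b) pre_digraph \<Rightarrow> 'a set \<Rightarrow> 'a set \<Rightarrow> 'b set" where
  "edges_between G X Y = {e \<in> arcs G. tail G e \<in> X \<and> head G e \<in> Y}"

definition hitting_number :: "('a, 'b) pre_digraph \<Rightarrow> 'a set set \<Rightarrow> nat" where
  "hitting_number G S = Min {card H | H. hitting_set G S H}"

definition egg_cut_number :: "('a, 'b) pre_digraph \<Rightarrow> 'a set set \<Rightarrow> nat" where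
  "egg_cut_number G S = Min {card (edges_between G X Y) | X Y. egg_cut G S X Y}"

definition scramble_order :: "('a, 'b) pre_digraph \<Rightarrow> 'a set set \<Rightarrow> nat" where
  "scramble_order G S =
     (if \<exists>X Y. egg_cut G S X Y then min (hitting_number G S) (egg_cut_number G S)
      else hitting_number G S)"

definition scramble_number :: "('a, 'b) pre_digraph \<Rightarrow> nat" where
  "scramble_number G = Max {scramble_order G S | S. is_scramble G S}"

definition connected_sets_of_size :: "('a, 'b) pre_digraph \<Rightarrow> nat \<Rightarrow> 'a set set" where
  "connected_sets_of_size G k = {E. connected_vertex_set G E \<and> card E = k}"

lemma is_scramble_connected_sets_of_size: "is_scramble G (connected_sets_of_size G k)"
  by (simp add: is_scramble_def connected_sets_of_size_def)

text \<open>
  On finite graphs every minimum and maximum above is taken over a finite nonempty set.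
\<close>

lemma
  assumes fin: "finite (verts G)" and S: "is_scramble G S"
  shows finite_hitting_set_cards: "finite {card H | H. hitting_set G S H}"
    and hitting_set_cards_nonempty: "{card H | H. hitting_set G S H} \<noteq> {}"
    and finite_egg_cut_cards: "finite {card (edges_between G X Y) | X Y. egg_cut G S X Y}"
proof -
  have "{card H | H. hitting_set G S H} \<subseteq> card ` Pow (verts G)"
    by (auto simp: hitting_set_def)
  then show "finite {card H | H. hitting_set G S H}"
    using fin by (meson finite_Pow_iff finite_imageI finite_subset)
  have "hitting_set G S (verts G)"
    using S unfolding hitting_set_def is_scramble_def connected_vertex_set_def by blast
  then show "{card H | H. hitting_set G S H} \<noteq> {}"
    by blast
  have "{card (edges_between G X Y) | X Y. egg_cut G S X Y}
        \<subseteq> (\<lambda>(X, Y). card (edges_between G X Y)) ` (Pow (verts G) \<times> Pow (verts G))"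
    by (auto simp: egg_cut_def)
  then show "finite {card (edges_between G X Y) | X Y. egg_cut G S X Y}"
    using fin by (meson finite_Pow_iff finite_SigmaI finite_imageI finite_subset)
qed

lemma
  assumes "finite (verts G)"
  shows finite_scramble_orders: "finite {scramble_order G S | S. is_scramble G S}"
    and scramble_orders_nonempty: "{scramble_order G S | S. is_scramble G S} \<noteq> {}"
proof -
  have "{scramble_order G S | S. is_scramble G S} \<subseteq> scramble_order G ` Pow (Pow (verts G))"
    by (auto simp: is_scramble_def connected_vertex_set_def)
  then show "finite {scramble_order G S | S. is_scramble G S}"
    using assms by (meson finite_Pow_iff finite_imageI finite_subset)
  show "{scramble_order G S | S. is_scramble G S} \<noteq> {}"
    using is_scramble_connected_sets_of_size by blast
qed

lemma pair_graph_cartesian_product: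
  assumes "pair_graph G" "pair_graph H"
  shows "pair_graph (G \<box> H)"
proof -
  interpret G: pair_graph G by fact
  interpret H: pair_graph H by fact
  have sub: "parcs (G \<box> H) \<subseteq> pverts (G \<box> H) \<times> pverts (G \<box> H)"
    by (auto simp: cartesian_product_def dest: G.in_arcsD1 G.in_arcsD2 H.in_arcsD1 H.in_arcsD2)
  have fin: "finite (pverts (G \<box> H))"
    by (simp add: cartesian_product_def G.pair_finite_verts H.pair_finite_verts)
  have irr: "fst e \<noteq> snd e" if "e \<in> parcs (G \<box> H)" for e
    using that G.pair_no_loops H.pair_no_loops by (fastforce simp: cartesian_product_def)
  have sym: "symmetric (with_proj (G \<box> H))"
    using G.pair_sym_arcs H.pair_sym_arcs
    by (auto simp: symmetric_def cartesian_product_def sym_def)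
  show ?thesis
    by unfold_locales (use sub fin irr sym in \<open>auto intro: finite_subset\<close>)
qed

end

theory Submission
  imports Defs
begin

text \<open>
  Call the fibres over the vertices of K_n rows (there are n of them, each a K_m) and the fibres
  over the vertices of K_m columns.

  Upper bound: either the complement of some row is a hitting set, or every row contains an
  egg; in the latter case separating one row from the others is an egg cut. Both have size
  (n - 1) m.

  Hitting sets of S*: the complement C of a hitting set has components of size at most n - 2, which
  lie in pairwise disjoint rows and columns. If every component meets only one row, then the
  sizes of the components count distinct columns, so card C is at most m. Otherwise there are
  at most n - 1 components, so card C is at most (n - 1) (n - 2), which is at most m.

  Egg cuts of S*: only the sizes of both sides, at least n - 1, matter. A line (row or column)
  of length l containing a elements of X contributes a (l - a) edges, which is at least l - 1 if
  both sides meet the line. If all rows or all columns are mixed in this way, summing suffices.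
  Otherwise some row and some column lie in the same side, because they cross, and the
  other side Z avoids both. Concavity of a (l - a) on each line then bounds the cut by a linear
  function of card Z and the numbers of rows and columns met by Z.
\<close>

section \<open>Edge boundaries in a product of two complete graphs\<close>

text \<open>For complete graphs on \<open>V\<close> and \<open>W\<close> this counts the edges from
  \<open>Z\<close> to its complement: the first sum runs over rows, the second over columns. Integer
  values keep the differences from being truncated.\<close>

definition boundary :: "'a set \<Rightarrow> 'b set \<Rightarrow> ('a \<times> 'b) set \<Rightarrow> int" where
  "boundary V W Z =
     (\<Sum>x\<in>V. int (card (Z `` {x})) * (int (card W) - int (card (Z `` {x})))) +
     (\<Sum>y\<in>W. int (card (Z\<inverse> `` {y})) * (int (card V) - int (card (Z\<inverse> `` {y}))))"

lemma card_eq_sum_card_Image: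
  assumes "finite Z"
  shows "card Z = (\<Sum>x\<in>fst ` Z. card (Z `` {x}))"
proof -
  have "Z = (SIGMA x:fst ` Z. Z `` {x})"
    by force
  moreover have "card (SIGMA x:fst ` Z. Z `` {x}) = (\<Sum>x\<in>fst ` Z. card (Z `` {x}))"
    using assms by (intro card_SigmaI) auto
  ultimately show ?thesis
    by simp
qed

text \<open>Each row meeting \<open>Z\<close> holds between 1 and \<open>q\<close> points, so
  concavity puts its term on or above the chord over that range. The chord is affine, so its sum
  depends only on \<open>p\<close>, \<open>q\<close> and \<open>z\<close>. Applied to the converse
  of \<open>Z\<close>, the lemma handles columns.\<close>

lemma sum_card_Image_ge:
  fixes M :: int
  assumes "finite V" "finite W" "Z \<subseteq> V \<times> W"
  defines "p \<equiv> int (card (fst ` Z))" and "q \<equiv> int (card (snd ` Z))" and "z \<equiv> int (card Z)"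
  shows "p * (M - 1) + (z - p) * (M - 1 - q)
           \<le> (\<Sum>x\<in>V. int (card (Z `` {x})) * (M - int (card (Z `` {x}))))"
proof -
  have fin: "finite Z"
    using assms(1-3) finite_subset by blast
  have chord: "(M - 1) + (int (card (Z `` {x})) - 1) * (M - 1 - q)
                \<le> int (card (Z `` {x})) * (M - int (card (Z `` {x})))" if "x \<in> fst ` Z" for x
  proof -
    define a where "a = int (card (Z `` {x}))"
    have "finite (Z `` {x})"
      using fin by (rule finite_Image)
    moreover have "Z `` {x} \<noteq> {}"
      using that by force
    ultimately have "1 \<le> a"
      unfolding a_def by (simp add: Suc_leI card_gt_0_iff)
    moreover have "Z `` {x} \<subseteq> snd ` Z"
      by force
    then have "a \<le> q"
      unfolding a_def q_def using fin by (simp add: card_mono)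
    \<comment> \<open>(a - 1) (q - a) is the excess of a (M - a) over its chord from a = 1 to a = q.\<close>
    ultimately have "0 \<le> (a - 1) * (q - a)"
      by simp
    then show ?thesis
      unfolding a_def[symmetric] by (simp add: algebra_simps)
  qed
  have "z = (\<Sum>x\<in>fst ` Z. int (card (Z `` {x})))"
    unfolding z_def using card_eq_sum_card_Image[OF fin] by simp
  then have "p * (M - 1) + (z - p) * (M - 1 - q)
        = (\<Sum>x\<in>fst ` Z. (M - 1) + (int (card (Z `` {x})) - 1) * (M - 1 - q))"
    by (simp add: sum.distrib sum_subtractf p_def flip: sum_distrib_right)
  also have "\<dots> \<le> (\<Sum>x\<in>fst ` Z. int (card (Z `` {x})) * (M - int (card (Z `` {x}))))"
    by (intro sum_mono chord)
  also have "\<dots> = (\<Sum>x\<in>V. int (card (Z `` {x})) * (M - int (card (Z `` {x}))))"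
  proof (intro sum.mono_neutral_left ballI)
    show "fst ` Z \<subseteq> V"
      using assms(3) by auto
    fix x assume "x \<in> V - fst ` Z"
    then have "Z `` {x} = {}"
      by force
    then show "int (card (Z `` {x})) * (M - int (card (Z `` {x}))) = 0"
      by simp
  qed fact
  finally show ?thesis .
qed

text \<open>On every line the complement merely swaps the two factors. This reduces full lines to
  empty ones.\<close>

lemma boundary_complement:
  assumes "finite V" "finite W" "Z \<subseteq> V \<times> W"
  shows "boundary V W (V \<times> W - Z) = boundary V W Z"
proof -
  have "int (card ((V \<times> W - Z) `` {x})) = int (card W) - int (card (Z `` {x}))" if "x \<in> V" for x
  proof -
    have "(V \<times> W - Z) `` {x} = W - Z `` {x}" "Z `` {x} \<subseteq> W"
      using assms(3) that by auto
    then show ?thesis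
      using assms(2) by (simp add: card_Diff_subset finite_subset card_mono of_nat_diff)
  qed
  moreover have "int (card ((V \<times> W - Z)\<inverse> `` {y})) = int (card V) - int (card (Z\<inverse> `` {y}))"
    if "y \<in> W" for y
  proof -
    have "(V \<times> W - Z)\<inverse> `` {y} = V - Z\<inverse> `` {y}" "Z\<inverse> `` {y} \<subseteq> V"
      using assms(3) that by auto
    then show ?thesis
      using assms(1) by (simp add: card_Diff_subset finite_subset card_mono of_nat_diff)
  qed
  ultimately show ?thesis
    unfolding boundary_def by (simp add: mult.commute)
qed

text \<open>Adding the chord bounds for rows and columns gives a bound that is linear in
  \<open>z\<close>. The empty row and column make its slope nonnegative, so \<open>z\<close> may be
  lowered to the larger of \<open>q\<close> and \<open>N\<close>.\<close>

lemma boundary_ge_if_empty_lines: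
  assumes fin: "finite V" "finite W" and Z: "Z \<subseteq> V \<times> W"
    and row: "x \<in> V" "Z `` {x} = {}" and col: "y \<in> W" "Z\<inverse> `` {y} = {}"
    and big: "int (card V) - 1 \<le> int (card Z)" and ne: "Z \<noteq> {}"
  shows "(int (card V) - 1) * int (card W) \<le> boundary V W Z"
proof -
  define p q z where "p = int (card (fst ` Z))" and "q = int (card (snd ` Z))"
    and "z = int (card Z)"
  define N m where "N = int (card V) - 1" and "m = int (card W)"
  have finZ: "finite Z"
    using fin Z finite_subset by blast
  have conv: "fst ` Z\<inverse> = snd ` Z" "snd ` Z\<inverse> = fst ` Z"
    by force+
  have "p * (m - 1) + (z - p) * (m - 1 - q) \<le>
          (\<Sum>x\<in>V. int (card (Z `` {x})) * (int (card W) - int (card (Z `` {x}))))"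
    unfolding p_def q_def z_def m_def by (rule sum_card_Image_ge) fact+
  moreover have "q * (int (card V) - 1) + (z - q) * (int (card V) - 1 - p) \<le>
          (\<Sum>y\<in>W. int (card (Z\<inverse> `` {y})) * (int (card V) - int (card (Z\<inverse> `` {y}))))"
    using sum_card_Image_ge[of W V "Z\<inverse>" "int (card V)"] fin Z
    unfolding conv p_def q_def z_def by (auto simp: card_inverse)
  ultimately have lower: "z * (m + N - 1 - p - q) + 2 * (p * q) \<le> boundary V W Z"
    unfolding boundary_def N_def by (simp add: algebra_simps)
  have "fst ` Z \<subset> V" "snd ` Z \<subset> W"
    using Z row col by force+
  then have "card (fst ` Z) < card V" "card (snd ` Z) < card W"
    using fin by (simp_all add: psubset_card_mono)
  then have pN: "p \<le> N" and qm: "q \<le> m - 1"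
    unfolding p_def q_def N_def m_def by linarith+
  have p1: "1 \<le> p" and q1: "1 \<le> q"
    using finZ ne unfolding p_def q_def by (simp_all add: Suc_leI card_gt_0_iff)
  have zq: "q \<le> z"
    unfolding q_def z_def using finZ by (simp add: card_image_le)
  have zN: "N \<le> z"
    using big unfolding N_def z_def .
  have "Z \<subseteq> fst ` Z \<times> snd ` Z"
    by force
  then have "card Z \<le> card (fst ` Z \<times> snd ` Z)"
    using finZ by (intro card_mono) auto
  then have zpq: "z \<le> p * q"
    unfolding z_def p_def q_def by (simp add: card_cartesian_product flip: of_nat_mult)
  have slope: "0 \<le> m + N - 1 - p - q"
    using pN qm by linarith
  have "N * m \<le> z * (m + N - 1 - p - q) + 2 * (p * q)"
  proof (cases "N \<le> q")
    case True
    \<comment> \<open>These two products add up to the surplus over \<open>N * m\<close> when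
      \<open>z\<close> is replaced by \<open>q\<close> in the slope term.\<close>
    have "0 \<le> (q - N) * (m - q)" "0 \<le> q * (p - 1)"
      using True qm p1 q1 by simp_all
    then have "N * m \<le> q * (m + N - 1 - p - q) + 2 * (p * q)"
      by (simp add: algebra_simps)
    moreover have "q * (m + N - 1 - p - q) \<le> z * (m + N - 1 - p - q)"
      using zq slope by (rule mult_right_mono)
    ultimately show ?thesis
      by linarith
  next
    case False
    \<comment> \<open>With \<open>N\<close> in place of \<open>z\<close> in the slope term, the
      surplus is \<open>(N - p) * (N - q) + (p * q - N)\<close>, and
      \<open>N \<le> z \<le> p * q\<close>.\<close>
    have "0 \<le> (N - p) * (N - q)"
      using False pN by simp
    then have "N * m \<le> N * (m + N - 1 - p - q) + 2 * (p * q)"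
      using zN zpq by (simp add: algebra_simps)
    moreover have "N * (m + N - 1 - p - q) \<le> z * (m + N - 1 - p - q)"
      using zN slope by (rule mult_right_mono)
    ultimately show ?thesis
      by linarith
  qed
  then show ?thesis
    using lower unfolding N_def m_def by linarith
qed

lemma mult_diff_ge:
  fixes a b :: int
  assumes "0 < a" "a < b"
  shows "b - 1 \<le> a * (b - a)"
proof -
  have "0 \<le> (a - 1) * (b - a - 1)"
    using assms by simp
  then show ?thesis
    by (simp add: algebra_simps)
qed

lemma sum_card_Image_ge_if_mixed:
  assumes fin: "finite V" "finite W" and Z: "Z \<subseteq> V \<times> W"
    and mixed: "\<And>x. x \<in> V \<Longrightarrow> Z `` {x} \<noteq> {} \<and> Z `` {x} \<noteq> W"
  shows "int (card V) * (int (card W) - 1)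
           \<le> (\<Sum>x\<in>V. int (card (Z `` {x})) * (int (card W) - int (card (Z `` {x}))))"
proof (rule sum_bounded_below)
  fix x assume "x \<in> V"
  then have "Z `` {x} \<noteq> {}" "Z `` {x} \<subset> W"
    using mixed Z by auto
  then have "0 < card (Z `` {x})" "card (Z `` {x}) < card W"
    using fin by (auto simp: card_gt_0_iff intro: finite_subset psubset_card_mono)
  then show "int (card W) - 1 \<le> int (card (Z `` {x})) * (int (card W) - int (card (Z `` {x})))"
    by (intro mult_diff_ge) auto
qed

lemma sum_card_Image_nonneg:
  assumes "finite W" "Z \<subseteq> V \<times> W"
  shows "0 \<le> (\<Sum>x\<in>V. int (card (Z `` {x})) * (int (card W) - int (card (Z `` {x}))))"
proof (intro sum_nonneg mult_nonneg_nonneg)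
  fix x
  have "Z `` {x} \<subseteq> W"
    using assms(2) by auto
  then show "0 \<le> int (card W) - int (card (Z `` {x}))"
    using assms(1) by (simp add: card_mono)
qed simp

lemma boundary_ge:
  assumes fin: "finite V" "finite W" and Z: "Z \<subseteq> V \<times> W"
    and le: "card V \<le> card W" and V: "2 \<le> card V"
    and big: "int (card V) - 1 \<le> int (card Z)" "int (card V) - 1 \<le> int (card (V \<times> W - Z))"
  shows "(int (card V) - 1) * int (card W) \<le> boundary V W Z"
proof -
  have Z': "Z\<inverse> \<subseteq> W \<times> V"
    using Z by auto
  consider (rows) "\<And>x. x \<in> V \<Longrightarrow> Z `` {x} \<noteq> {} \<and> Z `` {x} \<noteq> W"
    | (cols) "\<And>y. y \<in> W \<Longrightarrow> Z\<inverse> `` {y} \<noteq> {} \<and> Z\<inverse> `` {y} \<noteq> V"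
    | (pure) x y where "x \<in> V" "y \<in> W" "Z `` {x} = {} \<or> Z `` {x} = W"
        "Z\<inverse> `` {y} = {} \<or> Z\<inverse> `` {y} = V"
    by blast
  then show ?thesis
  proof cases
    case rows
    \<comment> \<open>The two sides differ by \<open>card W - card V\<close>; this is where
      \<open>card V \<le> card W\<close> enters.\<close>
    have "(int (card V) - 1) * int (card W) \<le> int (card V) * (int (card W) - 1)"
      using le by (simp add: algebra_simps)
    then show ?thesis
      using sum_card_Image_ge_if_mixed[OF fin Z rows] sum_card_Image_nonneg[OF fin(1) Z']
      unfolding boundary_def by linarith
  next
    case cols
    then show ?thesis
      using sum_card_Image_ge_if_mixed[OF fin(2,1) Z' cols] sum_card_Image_nonneg[OF fin(2) Z]
      unfolding boundary_def by (simp add: mult.commute)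
  next
    case pure
    \<comment> \<open>The point \<open>(x, y)\<close> lies on both lines, so one cannot be empty
      while the other is full.\<close>
    consider (empty) "Z `` {x} = {}" "Z\<inverse> `` {y} = {}"
      | (full) "Z `` {x} = W" "Z\<inverse> `` {y} = V"
      using pure by blast
    then show ?thesis
    proof cases
      case empty
      have "Z \<noteq> {}"
        using big(1) V by auto
      then show ?thesis
        using boundary_ge_if_empty_lines[OF fin Z] empty pure big(1) by blast
    next
      case full
      have "(V \<times> W - Z) `` {x} = {}" "(V \<times> W - Z)\<inverse> `` {y} = {}"
        using full by auto
      moreover have "V \<times> W - Z \<noteq> {}"
        using big(2) V by fastforce
      ultimately have "(int (card V) - 1) * int (card W) \<le> boundary V W (V \<times> W - Z)"
        using pure big(2) by (intro boundary_ge_if_empty_lines[OF fin]) auto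
      then show ?thesis
        using boundary_complement[OF fin Z] by simp
    qed
  qed
qed

section \<open>The boundary as an edge cut of the graph product\<close>

lemma parcs_product_complete:
  assumes "complete_digraph n (with_proj G)" "complete_digraph m (with_proj H)"
  shows "parcs (G \<box> H) = {(u, v). u \<in> pverts G \<times> pverts H \<and> v \<in> pverts G \<times> pverts H \<and> u \<noteq> v
           \<and> (fst u = fst v \<or> snd u = snd v)}"
  using assms unfolding complete_digraph_pair_def cartesian_product_def by auto

lemma pverts_product: "pverts (G \<box> H) = pverts G \<times> pverts H"
  by (simp add: cartesian_product_def)

text \<open>An arc leaving \<open>Z\<close> changes exactly one coordinate. Hence these arcs split
  into row arcs, encoded by the triples in \<open>R\<close>, and column arcs, encoded by those in
  \<open>C\<close>; the cardinalities of these Sigma sets are the two sums of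
  \<open>boundary\<close>.\<close>

lemma card_edges_between:
  assumes "complete_digraph n (with_proj G)" "complete_digraph m (with_proj H)"
    and Z: "Z \<subseteq> pverts G \<times> pverts H"
  shows "int (card (edges_between (with_proj (G \<box> H)) Z (pverts G \<times> pverts H - Z)))
           = boundary (pverts G) (pverts H) Z"
proof -
  define V W where "V = pverts G" and "W = pverts H"
  have fin: "finite V" "finite W"
    using assms by (simp_all add: complete_digraph_pair_def V_def W_def)
  have Z: "Z \<subseteq> V \<times> W"
    using Z unfolding V_def W_def .
  define R where "R = (SIGMA x:V. Z `` {x} \<times> (W - Z `` {x}))"
  define C where "C = (SIGMA y:W. Z\<inverse> `` {y} \<times> (V - Z\<inverse> `` {y}))"
  define r where "r = (\<lambda>(x, y1, y2). ((x :: 'a, y1 :: 'b), (x, y2 :: 'b)))"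
  define c where "c = (\<lambda>(y, x1, x2). ((x1 :: 'a, y :: 'b), (x2 :: 'a, y)))"
  have ZW: "Z `` {x} \<subseteq> W" and ZV: "Z\<inverse> `` {y} \<subseteq> V" for x y
    using Z by auto
  have finZ: "finite (Z `` {x})" "finite (Z\<inverse> `` {y})" for x y
    by (rule finite_subset[OF ZW fin(2)], rule finite_subset[OF ZV fin(1)])
  have "edges_between (with_proj (G \<box> H)) Z (V \<times> W - Z) = r ` R \<union> c ` C"
  proof (intro equalityI subsetI)
    fix e assume e: "e \<in> edges_between (with_proj (G \<box> H)) Z (V \<times> W - Z)"
    obtain x1 y1 x2 y2 where [simp]: "e = ((x1, y1), (x2, y2))"
      by (metis surj_pair)
    have ends: "(x1, y1) \<in> Z" "x2 \<in> V" "y2 \<in> W" "(x2, y2) \<notin> Z" "x1 = x2 \<or> y1 = y2"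
      using e unfolding edges_between_def with_proj_simps parcs_product_complete[OF assms(1,2)]
        V_def W_def by auto
    moreover have "x1 \<in> V" "y1 \<in> W"
      using ends Z by auto
    ultimately have "(x1, y1, y2) \<in> R \<and> x1 = x2 \<or> (y1, x1, x2) \<in> C \<and> y1 = y2"
      unfolding R_def C_def by auto
    then show "e \<in> r ` R \<union> c ` C"
      unfolding r_def c_def by force
  next
    fix e assume "e \<in> r ` R \<union> c ` C"
    then show "e \<in> edges_between (with_proj (G \<box> H)) Z (V \<times> W - Z)"
      using Z unfolding R_def C_def r_def c_def edges_between_def with_proj_simps
        parcs_product_complete[OF assms(1,2)] V_def W_def by auto
  qed
  moreover have "r ` R \<inter> c ` C = {}"
    unfolding R_def C_def r_def c_def by auto
  moreover have "finite R" "finite C"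
    unfolding R_def C_def using fin finZ by auto
  moreover have "inj_on r R" "inj_on c C"
    unfolding r_def c_def by (auto intro!: inj_onI)
  ultimately have "card (edges_between (with_proj (G \<box> H)) Z (V \<times> W - Z)) = card R + card C"
    by (simp add: card_Un_disjoint card_image)
  moreover have "int (card R) = (\<Sum>x\<in>V. int (card (Z `` {x})) * (int (card W) - int (card (Z `` {x}))))"
    unfolding R_def using fin finZ ZW
    by (subst card_SigmaI)
       (auto simp: card_cartesian_product card_Diff_subset card_mono of_nat_diff)
  moreover have "int (card C) = (\<Sum>y\<in>W. int (card (Z\<inverse> `` {y})) * (int (card V) - int (card (Z\<inverse> `` {y}))))"
    unfolding C_def using fin finZ ZV
    by (subst card_SigmaI)
       (auto simp: card_cartesian_product card_Diff_subset card_mono of_nat_diff)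
  ultimately show ?thesis
    unfolding boundary_def V_def W_def by simp
qed

section \<open>Connected sets, and the size of sets without large connected subsets\<close>

text \<open>Connectedness of the induced subgraph is strong connectedness of its symmetric closure;
  writing out that arc relation allows direct work with \<open>rtrancl_on\<close>.\<close>

lemma connected_vertex_set_iff:
  "connected_vertex_set (with_proj G) A \<longleftrightarrow> A \<noteq> {} \<and> A \<subseteq> pverts G \<and>
     (\<forall>u\<in>A. \<forall>v\<in>A. (u, v) \<in> rtrancl_on A
        {(u, v). u \<in> A \<and> v \<in> A \<and> ((u, v) \<in> parcs G \<or> (v, u) \<in> parcs G)})"
proof -
  have "parcs (mk_symmetric (with_proj G \<restriction> A))
          = {(u, v). u \<in> A \<and> v \<in> A \<and> ((u, v) \<in> parcs G \<or> (v, u) \<in> parcs G)}"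
    by (force simp: mk_symmetric_def)
  then show ?thesis
    unfolding connected_vertex_set_def connected_def strongly_connected_def reachable_def
    by auto
qed

lemma connected_vertex_set_singleton:
  "v \<in> pverts G \<Longrightarrow> connected_vertex_set (with_proj G) {v}"
  by (auto simp: connected_vertex_set_iff)

lemma connected_vertex_set_insert:
  assumes A: "connected_vertex_set (with_proj G) A"
    and v: "v \<in> pverts G" and a: "a \<in> A" and arc: "(a, v) \<in> parcs G"
  shows "connected_vertex_set (with_proj G) (insert v A)"
proof -
  define B where "B = insert v A"
  define r where "r = (\<lambda>A. {(u, v). u \<in> A \<and> v \<in> A \<and> ((u, v) \<in> parcs G \<or> (v, u) \<in> parcs G)})"
  have mono: "rtrancl_on A (r A) \<subseteq> rtrancl_on B (r B)"
    by (auto simp: B_def r_def intro: rtrancl_on_mono[rotated 2])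
  have AA: "(u, w) \<in> rtrancl_on B (r B)" if "u \<in> A" "w \<in> A" for u w
    using A that mono unfolding connected_vertex_set_iff r_def by blast
  have "(a, v) \<in> r B" "(v, a) \<in> r B" "a \<in> B" "v \<in> B"
    using a arc by (auto simp: B_def r_def)
  then have "(a, v) \<in> rtrancl_on B (r B)" "(v, a) \<in> rtrancl_on B (r B)"
    by (meson rtrancl_on.intros)+
  then have "(u, w) \<in> rtrancl_on B (r B)" if "u \<in> B" "w \<in> B" for u w
    using that AA a \<open>v \<in> B\<close> unfolding B_def by (metis insertE rtrancl_on_trans rtrancl_on_refl)
  then show ?thesis
    using A v unfolding connected_vertex_set_iff B_def r_def by auto
qed

text \<open>\<open>D\<close> is the component of \<open>v\<close> in \<open>C\<close>, found as a
  largest connected set through \<open>v\<close> with at most \<open>k\<close> elements. Growth by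
  single vertices cannot jump over the forbidden size \<open>Suc k\<close>, so a maximal set has no
  neighbour left in \<open>C\<close>.\<close>

lemma obtain_closed_connected_set:
  assumes C: "finite C" "C \<subseteq> pverts G" "v \<in> C"
    and none: "\<And>D. D \<subseteq> C \<Longrightarrow> connected_vertex_set (with_proj G) D \<Longrightarrow> card D \<noteq> Suc k"
  obtains D where "D \<subseteq> C" "v \<in> D" "card D \<le> k"
    "\<And>a u. a \<in> D \<Longrightarrow> u \<in> C - D \<Longrightarrow> (a, u) \<notin> parcs G"
proof -
  define P where "P = (\<lambda>D. D \<subseteq> C \<and> v \<in> D \<and> connected_vertex_set (with_proj G) D \<and> card D \<le> k)"
  have "connected_vertex_set (with_proj G) {v}"
    using C by (auto intro: connected_vertex_set_singleton)
  \<comment> \<open>Since \<open>{v}\<close> is connected, its size 1 is not \<open>Suc k\<close>;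
    hence \<open>k\<close> is at least 1.\<close>
  then have "P {v}"
    using none[of "{v}"] C unfolding P_def by auto
  then have "P (arg_max card P) \<and> (\<forall>E. P E \<longrightarrow> card E \<le> card (arg_max card P))"
    by (rule arg_max_nat_lemma[where b = "Suc k"]) (simp add: P_def)
  then obtain D where D: "P D" and max: "\<And>E. P E \<Longrightarrow> card E \<le> card D"
    by blast
  have "(a, u) \<notin> parcs G" if "a \<in> D" "u \<in> C - D" for a u
  proof
    assume "(a, u) \<in> parcs G"
    then have conn: "connected_vertex_set (with_proj G) (insert u D)"
      using D that C unfolding P_def by (blast intro: connected_vertex_set_insert)
    have card: "card (insert u D) = Suc (card D)"
      using D that C(1) unfolding P_def by (auto intro: card_insert_disjoint finite_subset)
    then have "Suc (card D) \<noteq> Suc k"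
      using none[OF _ conn] D that unfolding P_def by auto
    then have "P (insert u D)"
      using D conn card that unfolding P_def by auto
    from max[OF this] card show False
      by simp
  qed
  then show ?thesis
    using that D unfolding P_def by blast
qed

text \<open>Induction by splitting off one component \<open>D\<close>, which shares no row or column
  with the rest. The summand \<open>k\<close> in the last alternative records the saving from a
  component that meets two rows; the first conjunct bounds the rest in that case.\<close>

lemma card_le_if_no_connected_subset:
  assumes "complete_digraph n (with_proj G)" "complete_digraph m (with_proj H)"
    and "C \<subseteq> pverts G \<times> pverts H"
    and "\<And>D. D \<subseteq> C \<Longrightarrow> connected_vertex_set (with_proj (G \<box> H)) D \<Longrightarrow> card D \<noteq> Suc k"
  shows "card C \<le> k * card (fst ` C) \<and>
         (card C \<le> card (snd ` C) \<or> card C + k \<le> k * card (fst ` C))"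
  using assms(3,4)
proof (induction "card C" arbitrary: C rule: less_induct)
  case less
  have fin: "finite C"
    using assms(1,2) less.prems(1)
    by (auto simp: complete_digraph_pair_def intro: finite_subset)
  show ?case
  proof (cases "C = {}")
    case True
    then show ?thesis
      by simp
  next
    case False
    then obtain v where v: "v \<in> C"
      by blast
    obtain D where D: "D \<subseteq> C" "v \<in> D" "card D \<le> k"
      and closed: "\<And>a u. a \<in> D \<Longrightarrow> u \<in> C - D \<Longrightarrow> (a, u) \<notin> parcs (G \<box> H)"
      using obtain_closed_connected_set[of C "G \<box> H" v k] fin v less.prems
      unfolding pverts_product by metis
    \<comment> \<open>Distinct points in a common row or column are adjacent, which
      \<open>closed\<close> rules out between \<open>D\<close> and \<open>C - D\<close>.\<close>
    have disj: "fst ` D \<inter> fst ` (C - D) = {}" "snd ` D \<inter> snd ` (C - D) = {}"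
      using closed less.prems(1) D(1)
      unfolding parcs_product_complete[OF assms(1,2)] by fastforce+
    have C_eq: "C = D \<union> (C - D)"
      using D(1) by blast
    have finD: "finite D"
      using D(1) fin finite_subset by blast
    have cards: "card C = card D + card (C - D)"
      "card (fst ` C) = card (fst ` D) + card (fst ` (C - D))"
      "card (snd ` C) = card (snd ` D) + card (snd ` (C - D))"
      using fin finD D(1) disj C_eq
      by (metis Diff_disjoint card_Un_disjoint finite_Diff,
          metis card_Un_disjoint finite_Diff finite_imageI image_Un,
          metis card_Un_disjoint finite_Diff finite_imageI image_Un)
    have "card (C - D) < card C"
      using D(2) v fin finD cards(1) by (auto simp: card_gt_0_iff)
    then have IH: "card (C - D) \<le> k * card (fst ` (C - D))"
      "card (C - D) \<le> card (snd ` (C - D)) \<or> card (C - D) + k \<le> k * card (fst ` (C - D))"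
      using less.hyps[of "C - D"] less.prems by blast+
    have "1 \<le> card (fst ` D)"
      using D(2) finD by (auto simp: Suc_le_eq card_gt_0_iff)
    then consider (one) "card (fst ` D) = 1" | (more) "2 \<le> card (fst ` D)"
      by linarith
    then show ?thesis
    proof cases
      case one
      then obtain x where "fst ` D = {x}"
        by (rule card_1_singletonE)
      \<comment> \<open>Inside a single row, distinct points have distinct columns.\<close>
      then have "inj_on snd D"
        using imageI[of _ D fst] by (intro inj_onI prod_eqI) simp_all
      then have "card (snd ` D) = card D"
        by (rule card_image)
      then show ?thesis
        using IH D(3) one unfolding cards by auto
    next
      case more
      \<comment> \<open>One row pays for \<open>D\<close> itself, the second for the extra
        \<open>k\<close>.\<close>
      then have "k * 2 \<le> k * card (fst ` D)"
        by simp
      then show ?thesis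
        using IH(1) D(3) unfolding cards add_mult_distrib2 by linarith
    qed
  qed
qed

section \<open>Lower bounds for the connected sets of size \<open>n - 1\<close>\<close>

lemma hitting_set_card_ge:
  assumes G: "complete_digraph n (with_proj G)" and H: "complete_digraph m (with_proj H)"
    and n: "2 \<le> n" and m: "(n - 2) * (n - 1) \<le> m"
    and hit: "hitting_set (with_proj (G \<box> H)) (connected_sets_of_size (with_proj (G \<box> H)) (n - 1)) A"
  shows "(n - 1) * m \<le> card A"
proof -
  define V W where "V = pverts G" and "W = pverts H"
  have VW: "finite V" "finite W" "card V = n" "card W = m"
    using G H by (simp_all add: complete_digraph_pair_def V_def W_def)
  have A: "A \<subseteq> V \<times> W"
    using hit by (auto simp: hitting_set_def pverts_product V_def W_def)
  define C where "C = V \<times> W - A"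
  have C: "C \<subseteq> V \<times> W"
    unfolding C_def by blast
  \<comment> \<open>\<open>Suc (n - 2)\<close> is the egg size \<open>n - 1\<close>, and the
    complement of a hitting set contains no egg.\<close>
  have "card D \<noteq> Suc (n - 2)"
    if "D \<subseteq> C" "connected_vertex_set (with_proj (G \<box> H)) D" for D
    using hit that n unfolding hitting_set_def connected_sets_of_size_def C_def by auto
  then have *: "card C \<le> card (snd ` C) \<or> card C + (n - 2) \<le> (n - 2) * card (fst ` C)"
    using card_le_if_no_connected_subset[OF G H] C unfolding V_def W_def by blast
  have "fst ` C \<subseteq> V" "snd ` C \<subseteq> W"
    using C by auto
  then have le: "card (fst ` C) \<le> n" "card (snd ` C) \<le> m"
    using VW by (metis card_mono)+
  have "card C \<le> m"
  proof (cases "card C \<le> card (snd ` C)")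
    case True
    then show ?thesis
      using le by simp
  next
    case False
    then have "card C + (n - 2) \<le> (n - 2) * n"
      using * le(1) by (meson le_trans mult_le_mono2)
    \<comment> \<open>Cancelling the saved \<open>n - 2\<close> leaves
      \<open>(n - 2) * (n - 1)\<close>, which the hypothesis bounds by \<open>m\<close>.\<close>
    moreover have "(n - 2) * n = (n - 2) * (n - 1) + (n - 2)"
      using n by (cases n) auto
    ultimately show ?thesis
      using m by linarith
  qed
  moreover have "card C = n * m - card A"
    unfolding C_def using A VW
    by (simp add: card_Diff_subset finite_subset card_cartesian_product)
  moreover have "(n - 1) * m = n * m - m"
    by (simp add: diff_mult_distrib)
  ultimately show ?thesis
    by linarith
qed

lemma egg_cut_card_ge:
  assumes G: "complete_digraph n (with_proj G)" and H: "complete_digraph m (with_proj H)"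
    and n: "2 \<le> n" "n \<le> m"
    and cut: "egg_cut (with_proj (G \<box> H)) (connected_sets_of_size (with_proj (G \<box> H)) (n - 1)) X Y"
  shows "(n - 1) * m \<le> card (edges_between (with_proj (G \<box> H)) X Y)"
proof -
  define V W where "V = pverts G" and "W = pverts H"
  have VW: "finite V" "finite W" "card V = n" "card W = m"
    using G H by (simp_all add: complete_digraph_pair_def V_def W_def)
  have X: "X \<subseteq> V \<times> W" and Y: "Y = V \<times> W - X"
    using cut by (auto simp: egg_cut_def pverts_product V_def W_def)
  obtain E1 E2 where "E1 \<subseteq> X" "E2 \<subseteq> Y" "card E1 = n - 1" "card E2 = n - 1"
    using cut by (auto simp: egg_cut_def connected_sets_of_size_def)
  moreover have "finite X" "finite Y"
    using X Y VW by (auto intro: finite_subset)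
  ultimately have "n - 1 \<le> card X" "n - 1 \<le> card Y"
    by (metis card_mono)+
  then have "(int n - 1) * int m \<le> boundary V W X"
    using boundary_ge[of V W X] X Y VW n by auto
  moreover have "int (n - 1) = int n - 1"
    using n by linarith
  ultimately have "int ((n - 1) * m) \<le> int (card (edges_between (with_proj (G \<box> H)) X Y))"
    using card_edges_between[OF G H, of X] X Y unfolding V_def W_def of_nat_mult by metis
  then show ?thesis
    by (rule of_nat_le_iff[THEN iffD1])
qed

section \<open>Upper bound for arbitrary scrambles and the final value\<close>

lemma scramble_order_le:
  assumes G: "complete_digraph n (with_proj G)" and H: "complete_digraph m (with_proj H)"
    and n: "2 \<le> n" and S: "is_scramble (with_proj (G \<box> H)) S"
  shows "scramble_order (with_proj (G \<box> H)) S \<le> (n - 1) * m"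
proof -
  define V W where "V = pverts G" and "W = pverts H"
  have VW: "finite V" "finite W" "card V = n" "card W = m"
    using G H by (simp_all add: complete_digraph_pair_def V_def W_def)
  have fin: "finite (verts (with_proj (G \<box> H)))"
    using VW by (simp add: pverts_product V_def W_def)
  have verts: "verts (with_proj (G \<box> H)) = V \<times> W"
    by (simp add: pverts_product V_def W_def)
  show ?thesis
  proof (cases "\<exists>x\<in>V. hitting_set (with_proj (G \<box> H)) S ((V - {x}) \<times> W)")
    case True
    then obtain x where x: "x \<in> V" "hitting_set (with_proj (G \<box> H)) S ((V - {x}) \<times> W)"
      by blast
    have "hitting_number (with_proj (G \<box> H)) S \<le> card ((V - {x}) \<times> W)"
      unfolding hitting_number_def using finite_hitting_set_cards[OF fin S] x by (intro Min_le) auto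
    also have "\<dots> = (n - 1) * m"
      using x VW by (simp add: card_cartesian_product)
    finally show ?thesis
      unfolding scramble_order_def by auto
  next
    case False
    \<comment> \<open>An egg missed by all rows other than \<open>x\<close> must lie in row
      \<open>x\<close>.\<close>
    have egg: "\<exists>E\<in>S. E \<subseteq> {x} \<times> W" if x: "x \<in> V" for x
    proof -
      have "(V - {x}) \<times> W \<subseteq> V \<times> W"
        by blast
      then obtain E where E: "E \<in> S" "((V - {x}) \<times> W) \<inter> E = {}"
        using False x unfolding hitting_set_def verts by blast
      moreover have "E \<subseteq> V \<times> W"
        using S E(1) unfolding is_scramble_def connected_vertex_set_def verts by blast
      ultimately have "E \<subseteq> {x} \<times> W"
        by auto
      then show ?thesis
        using E(1) by blast
    qed
    obtain x where x: "x \<in> V"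
      using VW n by fastforce
    \<comment> \<open>A second row supplies the egg on the other side of the cut.\<close>
    have "card (V - {x}) \<noteq> 0"
      using VW n x by simp
    then have "V - {x} \<noteq> {}"
      by (metis card.empty)
    then obtain x' where x': "x' \<in> V" "x' \<noteq> x"
      by blast
    define Z where "Z = {x} \<times> W"
    obtain E1 E2 where E: "E1 \<in> S" "E2 \<in> S" "E1 \<subseteq> {x} \<times> W" "E2 \<subseteq> {x'} \<times> W"
      using egg x x' by meson
    have cut: "egg_cut (with_proj (G \<box> H)) S Z (V \<times> W - Z)"
      unfolding egg_cut_def verts
    proof (intro conjI bexI)
      show "E2 \<subseteq> V \<times> W - Z"
        using E(4) x' unfolding Z_def by auto
    qed (use E x in \<open>auto simp: Z_def\<close>)
    \<comment> \<open>Every row is empty or full and contributes 0; every column meets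
      \<open>Z\<close> in one point and contributes \<open>n - 1\<close>.\<close>
    have "Z `` {u} = (if u = x then W else {})" for u
      unfolding Z_def by auto
    then have "(\<Sum>u\<in>V. int (card (Z `` {u})) * (int (card W) - int (card (Z `` {u})))) = 0"
      by (intro sum.neutral) simp
    moreover have "Z\<inverse> `` {y} = {x}" if "y \<in> W" for y
      using that unfolding Z_def by auto
    ultimately have "boundary V W Z = int ((n - 1) * m)"
      unfolding boundary_def using VW n by (simp add: of_nat_diff)
    moreover have "Z \<subseteq> V \<times> W"
      using x unfolding Z_def by blast
    ultimately have card: "card (edges_between (with_proj (G \<box> H)) Z (V \<times> W - Z)) = (n - 1) * m"
      using card_edges_between[OF G H, of Z] unfolding V_def W_def by (metis of_nat_eq_iff)
    have "egg_cut_number (with_proj (G \<box> H)) S \<le> (n - 1) * m"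
      unfolding egg_cut_number_def card[symmetric]
      using finite_egg_cut_cards[OF fin S] cut by (intro Min_le) blast+
    then show ?thesis
      unfolding scramble_order_def using cut by auto
  qed
qed

theorem theorem1p2:
  fixes n m :: nat
    and G :: "'a pair_pre_digraph"
    and H :: "'b pair_pre_digraph"
  assumes "complete_digraph n (with_proj G)"
    and "complete_digraph m (with_proj H)"
    and "2 \<le> n" and "n \<le> m" and "m \<ge> (n - 2) * (n - 1)"
  shows "scramble_number (with_proj (G \<box> H))
           = scramble_order (with_proj (G \<box> H)) (connected_sets_of_size (with_proj (G \<box> H)) (n - 1))
       \<and> scramble_order (with_proj (G \<box> H)) (connected_sets_of_size (with_proj (G \<box> H)) (n - 1))
           = (n - 1) * m"
proof -
  define P where "P = with_proj (G \<box> H)"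
  define S where "S = connected_sets_of_size P (n - 1)"
  have fin: "finite (verts P)"
    using assms(1,2) by (simp add: P_def complete_digraph_pair_def pverts_product)
  have S: "is_scramble P S"
    unfolding S_def by (rule is_scramble_connected_sets_of_size)
  have le: "scramble_order P T \<le> (n - 1) * m" if "is_scramble P T" for T
    using scramble_order_le[OF assms(1-3)] that unfolding P_def by blast
  have "(n - 1) * m \<le> hitting_number P S"
    unfolding hitting_number_def
    using finite_hitting_set_cards[OF fin S] hitting_set_cards_nonempty[OF fin S]
      hitting_set_card_ge[OF assms(1,2,3,5)]
    by (subst Min_ge_iff) (auto simp: S_def P_def)
  \<comment> \<open>Without an egg cut the minimum would range over the empty set, so the bound is
    conditional, matching the case split in \<open>scramble_order\<close>.\<close>
  moreover have "(n - 1) * m \<le> egg_cut_number P S" if "\<exists>X Y. egg_cut P S X Y"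
    unfolding egg_cut_number_def
    using finite_egg_cut_cards[OF fin S] that egg_cut_card_ge[OF assms(1-4)]
    by (subst Min_ge_iff) (auto simp: S_def P_def)
  ultimately have order: "scramble_order P S = (n - 1) * m"
    using le[OF S] unfolding scramble_order_def by (smt (verit) min_def order_antisym)
  moreover have "scramble_number P = (n - 1) * m"
    unfolding scramble_number_def
  proof (rule Max_eqI)
    show "(n - 1) * m \<in> {scramble_order P T |T. is_scramble P T}"
      unfolding mem_Collect_eq using order[symmetric] S by (intro exI conjI)
  qed (use finite_scramble_orders[OF fin] le in blast)+
  ultimately show ?thesis
    unfolding S_def P_def by simp
qed

end
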